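(* Let $\omega_1,\omega_2,\ldots$ be i.i.d. random variables uniformly distributed on $[0,\frac{\pi}{2}]$, and for each $n\in\mathbb{N}$ write $\mathcal{D}_n(\omega)=\mathcal{D}_n(\omega_1,\ldots,\omega_n)$. Then there exists $C>0$ such that for any $\theta\in[0,\pi]$, $$\mathbb{E}_{\omega}\Big|\mathrm{Proj}_{\theta}\,\mathcal{D}_n(\omega)\Big|\le \frac{C}{n}\quad\text{for all } n\in\mathbb{N}.$$ Consequently, $$\mathbb{E}_{\omega}\big[\mathrm{Fav}(\mathcal{D}_n(\omega))\big]\le \frac{C}{n}\quad\text{for all } n\in\mathbb{N},$$ and, almost surely, $$\liminf_{n\to\infty}\ n\cdot \mathrm{Fav}(\mathcal{D}_n(\omega))<\infty .$$
   Context: Notation. For $A\subset\mathbb{R}$ (or a subset of a line) measurable, $|A|$ is its one-dimensional Lebesgue measure. For $\theta\in[0,\pi]$, $\mathrm{Proj}_\theta$ is the orthogonal projection of the plane $\mathbb{C}$ onto the line through the origin having angle $\theta$ with the real axis. The Favard length of a planar set $E\subset\mathbb{C}$ is $$\mathrm{Fav}(E)=\frac1\pi\int_0^\pi \big|\mathrm{Proj}_\theta E\big|\,d\theta .$$ Construction of $\mathcal{D}_n$. Let $\mathcal{D}_0=\{z\in\mathbb{C}:|z|\le 1\}$. For $\alpha\in[0,\frac{\pi}{2}]$ and $j\in\{0,1,2,3\}$ let $T_j^{\alpha}(z)=\frac14 z+\frac34 e^{i(\frac{\pi}{2}j-\alpha)}$. Set $\mathcal{D}_1(\omega_1)=\bigcup_{j=0}^3T_j^{\omega_1}(\mathcal{D}_0)$.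 Inductively, $\mathcal{D}_k(\omega_1,\ldots,\omega_k)$ is obtained from $\mathcal{D}_{k-1}(\omega_1,\ldots,\omega_{k-1})$, a union of $4^{k-1}$ disks of radius $4^{-k+1}$, by replacing each of these disks by the translate, to the center of that disk, of the set $\bigcup_{j=0}^3\frac{1}{4^{k-1}}T_j^{\omega_k}(\mathcal{D}_0)$. Equivalently, $\mathcal{D}_k(\omega_1,\ldots,\omega_k)$ is the union, over all $(j_1,\ldots,j_k)\in\{0,1,2,3\}^k$, of the closed disks of radius $4^{-k}$ centered at $\sum_{i=1}^k \frac34\,4^{-(i-1)}e^{i_0(\frac{\pi}{2}j_i-\omega_i)}$, where $i_0=\sqrt{-1}$. $\mathbb{E}_\omega$ denotes expectation with respect to the random variables $\omega_1,\omega_2,\ldots$. *)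

theory Defs
  imports "HOL-Probability.Probability"
begin

definition line_proj :: "real \<Rightarrow> complex \<Rightarrow> complex" where
  "line_proj \<theta> z = complex_of_real (z \<bullet> cis \<theta>) * cis \<theta>"

text \<open>One-dimensional Lebesgue measure of a subset of the line through the origin with angle
  \<open>\<theta>\<close>, transported along the isometric parametrization \<open>t \<mapsto> t e\<^sup>i\<^sup>\<theta>\<close>.\<close>

definition line_measure :: "real \<Rightarrow> complex set \<Rightarrow> ennreal" where
  "line_measure \<theta> A = emeasure lebesgue {t :: real. complex_of_real t * cis \<theta> \<in> A}"

text \<open>Lengths and their averages are kept in \<^typ>\<open>ennreal\<close>, so that no default value can
  arise for infinite measures or divergent integrals.\<close>

definition Fav :: "complex set \<Rightarrow> ennreal" where
  "Fav E = (\<integral>\<^sup>+\<theta>\<in>{0..pi}. line_measure \<theta> (line_proj \<theta> ` E) \<partial>lebesgue) / ennreal pi"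

definition T :: "nat \<Rightarrow> real \<Rightarrow> complex \<Rightarrow> complex" where
  "T j \<alpha> z = z / 4 + 3 / 4 * cis (pi / 2 * real j - \<alpha>)"

text \<open>\<open>centers \<omega> k\<close> is the set of centers of the disks making up generation \<open>k\<close>. Angles are
  numbered from 1: generation \<open>k\<close> depends on \<open>\<omega> 1, \<dots>, \<omega> k\<close> only.\<close>

primrec centers :: "(nat \<Rightarrow> real) \<Rightarrow> nat \<Rightarrow> complex set" where
  "centers \<omega> 0 = {0}"
| "centers \<omega> (Suc k) = (\<Union>c\<in>centers \<omega> k. (\<lambda>j. c + T j (\<omega> (Suc k)) 0 / 4 ^ k) ` {0..3})"

primrec random_disks :: "(nat \<Rightarrow> real) \<Rightarrow> nat \<Rightarrow> complex set" where
  "random_disks \<omega> 0 = cball 0 1"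
| "random_disks \<omega> (Suc k) =
     (\<Union>c\<in>centers \<omega> k. (\<lambda>z. c + z) `
        (\<Union>j\<in>{0..3}. (\<lambda>z. z / 4 ^ k) ` T j (\<omega> (Suc k)) ` cball 0 1))"

lemma line_proj_orthogonal:
  "(z - line_proj \<theta> z) \<bullet> (complex_of_real t * cis \<theta>) = 0"
proof -
  have "cis \<theta> \<bullet> cis \<theta> = 1" by (simp add: dot_square_norm)
  then show ?thesis
    by (simp add: line_proj_def scaleR_conv_of_real[symmetric] inner_diff_left)
qed

lemma line_measure_line_proj:
  "line_measure \<theta> (line_proj \<theta> ` E) = emeasure lebesgue ((\<lambda>z. z \<bullet> cis \<theta>) ` E)"
proof -
  have "{t :: real. complex_of_real t * cis \<theta> \<in> line_proj \<theta> ` E} = (\<lambda>z. z \<bullet> cis \<theta>) ` E"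
    by (auto simp: line_proj_def image_iff)
  then show ?thesis by (simp add: line_measure_def)
qed

lemma centers_eq:
  "centers \<omega> k =
     (\<lambda>j. \<Sum>i=1..k. 3 / 4 / 4 ^ (i - 1) * cis (pi / 2 * real (j i) - \<omega> i)) ` {j. \<forall>i\<in>{1..k}. j i \<in> {0..3}}"
proof (induction k)
  case 0
  have "{j :: nat \<Rightarrow> nat. \<forall>i\<in>{1..0}. j i \<in> {0..3}} = UNIV" by auto
  then show ?case by simp
next
  case (Suc k)
  let ?s = "\<lambda>k j. \<Sum>i=1..k. 3 / 4 / 4 ^ (i - 1) * cis (pi / 2 * real (j i) - \<omega> i)"
  let ?J = "\<lambda>k. {j :: nat \<Rightarrow> nat. \<forall>i\<in>{1..k}. j i \<in> {0..3}}"
  have step: "?s (Suc k) j = ?s k j + T (j (Suc k)) (\<omega> (Suc k)) 0 / 4 ^ k" for j :: "nat \<Rightarrow> nat"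
    by (simp add: T_def)
  show ?case
  proof (intro equalityI subsetI)
    fix x assume "x \<in> centers \<omega> (Suc k)"
    then obtain j m where j: "j \<in> ?J k" and m: "m \<in> {0..3}"
      and x: "x = ?s k j + T m (\<omega> (Suc k)) 0 / 4 ^ k"
      using Suc.IH by auto
    let ?j = "j(Suc k := m)"
    have "?s k ?j = ?s k j" by (intro sum.cong) auto
    then have "x = ?s (Suc k) ?j" unfolding step x by simp
    moreover have "?j \<in> ?J (Suc k)" using j m by auto
    ultimately show "x \<in> ?s (Suc k) ` ?J (Suc k)" by blast
  next
    fix x assume "x \<in> ?s (Suc k) ` ?J (Suc k)"
    then obtain j where j: "j \<in> ?J (Suc k)" and x: "x = ?s (Suc k) j" by blast
    have "j \<in> ?J k" "j (Suc k) \<in> {0..3}" using j by auto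
    moreover from this(1) have "?s k j \<in> centers \<omega> k" unfolding Suc.IH by blast
    ultimately show "x \<in> centers \<omega> (Suc k)" unfolding x step centers.simps by blast
  qed
qed

lemma random_disks_eq: "random_disks \<omega> k = (\<Union>c\<in>centers \<omega> k. cball c (1 / 4 ^ k))"
proof (cases k)
  case 0
  then show ?thesis by simp
next
  case (Suc m)
  have "(\<lambda>z. c + z) ` (\<lambda>z. z / 4 ^ m) ` T j \<alpha> ` cball 0 1 =
        cball (c + T j \<alpha> 0 / 4 ^ m) (1 / 4 ^ Suc m)" for c j \<alpha>
  proof -
    have "(\<lambda>z. c + z) ` (\<lambda>z. z / 4 ^ m) ` T j \<alpha> ` cball 0 1 =
          (+) (c + T j \<alpha> 0 / 4 ^ m) ` (*\<^sub>R) (1 / 4 ^ Suc m) ` cball 0 1"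
      unfolding image_image
      by (intro image_cong) (auto simp: T_def field_simps scaleR_conv_of_real)
    also have "\<dots> = cball (c + T j \<alpha> 0 / 4 ^ m) (1 / 4 ^ Suc m)"
    proof -
      have "(*\<^sub>R) (1 / 4 ^ Suc m) ` cball (0 :: complex) 1 = cball 0 (1 / 4 ^ Suc m)"
        by (subst cball_scale) auto
      then show ?thesis by (simp add: cball_translation[symmetric] del: power_Suc)
    qed
    finally show ?thesis .
  qed
  then have "random_disks \<omega> k =
      (\<Union>c\<in>centers \<omega> m. \<Union>j\<in>{0..3}. cball (c + T j (\<omega> (Suc m)) 0 / 4 ^ m) (1 / 4 ^ Suc m))"
    unfolding Suc random_disks.simps image_UN by presburger
  also have "\<dots> = (\<Union>c\<in>centers \<omega> k. cball c (1 / 4 ^ k))"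
    unfolding Suc centers.simps by blast
  finally show ?thesis .
qed

end

theory Submission
  imports Defs
begin

text \<open>Let \<open>P\<^sub>n\<close> be the projection of the \<open>n\<close>-th generation. Peeling off the first angle,
  \<open>P\<^sub>n\<^sub>+\<^sub>1\<close> is the union of four translates of \<open>P\<^sub>n/4\<close>, by \<open>\<plusminus>(3/4) cos u\<close> and \<open>\<plusminus>(3/4) sin u\<close>, where
  \<open>u = \<omega>\<^sub>1 + \<theta>\<close> is independent of \<open>P\<^sub>n\<close>. Hence \<open>|P\<^sub>n\<^sub>+\<^sub>1|\<close> is at most \<open>|P\<^sub>n|\<close> minus the overlap of the last two
  translates. The union is \<open>\<pi>/2\<close>-periodic in \<open>u\<close>, so \<open>u\<close> may be taken uniform on
  \<open>[-\<pi>/4, \<pi>/4]\<close>; there the relative displacement \<open>6 sin u\<close> (after rescaling by 4) covers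
  all of \<open>P\<^sub>n - P\<^sub>n \<subseteq> [-2, 2]\<close> with density bounded below, so the mean overlap is at least
  \<open>|P\<^sub>n|\<^sup>2 / (12\<pi>)\<close>. By Jensen the mean lengths satisfy \<open>a\<^sub>n\<^sub>+\<^sub>1 \<le> a\<^sub>n - a\<^sub>n\<^sup>2 / (12\<pi>)\<close>, which forces
  \<open>a\<^sub>n \<le> 12\<pi> / n\<close>. Tonelli and Fatou give the statements on the Favard length.\<close>

text \<open>\<open>fan (\<alpha> + \<theta>) Q\<close> is the projection onto direction \<open>\<theta>\<close> of the union of the four \<open>T j \<alpha> ` E\<close>
  when \<open>Q\<close> is the projection of \<open>E\<close>.\<close>

definition fan :: "real \<Rightarrow> real set \<Rightarrow> real set" where
  "fan u Q = {t. 4 * t - 3 * cos u \<in> Q \<or> 4 * t - 3 * sin u \<in> Q \<or>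
                 4 * t + 3 * cos u \<in> Q \<or> 4 * t + 3 * sin u \<in> Q}"

section \<open>Unions of four quarter-scale copies of a set of reals\<close>

text \<open>A quarter turn only permutes the four displacements, \<plusminus>3 cos u and
  \<plusminus>3 sin u.\<close>

lemma fan_periodic: "fan (u + pi / 2) Q = fan u Q"
proof -
  have "cos (u + pi / 2) = - sin u" "sin (u + pi / 2) = cos u"
    by (simp_all add: cos_add sin_add)
  then show ?thesis by (auto simp: fan_def)
qed

lemma nn_integral_shift_window:
  fixes h :: "real \<Rightarrow> ennreal"
  assumes [measurable]: "h \<in> borel_measurable borel"
  shows "(\<integral>\<^sup>+u\<in>{a..<b}. h (u + c) \<partial>lborel) = (\<integral>\<^sup>+u\<in>{a + c..<b + c}. h u \<partial>lborel)"
  by (subst nn_integral_real_affine[where t = c and c = 1])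
    (auto intro!: nn_integral_cong simp: add.commute split: split_indicator)

text \<open>The two windows differ by \<open>{a..<b}\<close> and \<open>{a + p..<b + p}\<close>,
  which carry equal integrals. Being half-open, the pieces tile without common endpoints.\<close>

lemma nn_integral_periodic_window:
  fixes h :: "real \<Rightarrow> ennreal"
  assumes [measurable]: "h \<in> borel_measurable borel"
    and per: "\<And>u. h (u + p) = h u" and ab: "a \<le> b" "b \<le> a + p"
  shows "(\<integral>\<^sup>+u\<in>{a..<a + p}. h u \<partial>lborel) = (\<integral>\<^sup>+u\<in>{b..<b + p}. h u \<partial>lborel)"
proof -
  have split: "(\<integral>\<^sup>+u\<in>{x..<z}. h u \<partial>lborel) = (\<integral>\<^sup>+u\<in>{x..<y}. h u \<partial>lborel) + (\<integral>\<^sup>+u\<in>{y..<z}. h u \<partial>lborel)"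
    if "x \<le> y" "y \<le> z" for x y z
    using that by (subst nn_integral_add[symmetric])
      (auto intro!: nn_integral_cong split: split_indicator)
  have "(\<integral>\<^sup>+u\<in>{a..<b}. h u \<partial>lborel) = (\<integral>\<^sup>+u\<in>{a + p..<b + p}. h u \<partial>lborel)"
    using nn_integral_shift_window[where h = h and a = a and b = b and c = p] by (simp add: per)
  then show ?thesis
    using split[of a b "a + p"] split[of b "a + p" "b + p"] ab by (simp add: add.commute)
qed

lemma emeasure_quarter:
  fixes Q :: "real set"
  assumes [measurable]: "Q \<in> sets borel"
  shows "emeasure lborel {t. 4 * t + c \<in> Q} = emeasure lborel Q / 4"
proof -
  have [measurable]: "{t. 4 * t + c \<in> Q} \<in> sets borel" by measurable
  have "emeasure lborel Q = 4 * (\<integral>\<^sup>+t. indicator Q (c + 4 * t) \<partial>lborel)"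
    using nn_integral_real_affine[of "indicator Q" 4 c] by simp
  also have "(\<integral>\<^sup>+t. indicator Q (c + 4 * t) \<partial>lborel) = (\<integral>\<^sup>+t. indicator {t. 4 * t + c \<in> Q} t \<partial>lborel)"
    by (intro nn_integral_cong) (auto simp: add.commute split: split_indicator)
  also have "\<dots> = emeasure lborel {t. 4 * t + c \<in> Q}" by simp
  finally have "emeasure lborel Q = emeasure lborel {t. 4 * t + c \<in> Q} * 4" by (simp add: mult.commute)
  then show ?thesis by (simp add: ennreal_mult_divide_eq)
qed

text \<open>Each copy has a quarter of the measure of \<open>Q\<close>. Subadditivity bounds the
  cosine pair, while inclusion-exclusion is exact on the sine pair and so saves its overlap.\<close>

lemma fan_add_overlap_le:
  fixes Q :: "real set"
  assumes [measurable]: "Q \<in> sets borel"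
  shows "emeasure lborel (fan u Q) + emeasure lborel {t. 4 * t - 3 * sin u \<in> Q \<and> 4 * t + 3 * sin u \<in> Q}
    \<le> emeasure lborel Q"
proof -
  define A where "A c = {t :: real. 4 * t + c \<in> Q}" for c
  have [measurable]: "A c \<in> sets borel" for c unfolding A_def by measurable
  have A: "emeasure lborel (A c) = emeasure lborel Q / 4" for c
    unfolding A_def by (rule emeasure_quarter) measurable
  let ?s = "3 * sin u" and ?c = "3 * cos u"
  have "emeasure lborel (fan u Q) + emeasure lborel {t. 4 * t - 3 * sin u \<in> Q \<and> 4 * t + 3 * sin u \<in> Q}
     = emeasure lborel (A (- ?c) \<union> A ?c \<union> (A (- ?s) \<union> A ?s)) + emeasure lborel (A (- ?s) \<inter> A ?s)"
    by (intro arg_cong2[where f = "(+)"] arg_cong[where f = "emeasure lborel"]) (auto simp: fan_def A_def)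
  also have "\<dots> \<le> emeasure lborel (A (- ?c)) + emeasure lborel (A ?c) + emeasure lborel (A (- ?s) \<union> A ?s)
      + emeasure lborel (A (- ?s) \<inter> A ?s)"
    by (intro add_mono order_refl order_trans[OF emeasure_subadditive]) auto
  also have "\<dots> = emeasure lborel (A (- ?c)) + emeasure lborel (A ?c)
      + (emeasure lborel (A (- ?s)) + emeasure lborel (A ?s))"
    by (subst emeasure_Un_Int[of "A (- ?s)" lborel "A ?s"]) (auto simp: add.assoc)
  also have "\<dots> = emeasure lborel Q"
    unfolding A
    by (cases "emeasure lborel Q")
      (simp_all add: ennreal_divide_numeral ennreal_top_divide ennreal_plus[symmetric] del: ennreal_plus)
  finally show ?thesis .
qed

section \<open>Averaging the overlap over the angle\<close>

text \<open>Substitute x = 6 sin u, with Jacobian 6 cos u at most 6. The interval [-3, 3] is swept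
  exactly once for u in [-pi/6, pi/6], which lies inside the window.\<close>

lemma sin_level_measure_ge:
  fixes B :: "real set"
  assumes [measurable]: "B \<in> sets borel" and B: "B \<subseteq> {-3..3}"
  shows "emeasure lborel B \<le> 6 * emeasure lborel {u \<in> {-pi/4..<pi/4}. 6 * sin u \<in> B}"
proof -
  have [measurable]: "{u \<in> {-pi/4..<pi/4}. 6 * sin u \<in> B} \<in> sets borel" by measurable
  have ends: "6 * sin (- (pi / 6)) = - 3" "6 * sin (pi / 6) = 3" by (simp_all add: sin_30)
  have "emeasure lborel B = (\<integral>\<^sup>+x. indicator B x * indicator {6 * sin (- (pi / 6))..6 * sin (pi / 6)} x \<partial>lborel)"
    unfolding ends nn_integral_indicator[OF assms(1)[folded sets_lborel], symmetric]
    using B by (intro nn_integral_cong) (auto split: split_indicator)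
  also have "\<dots> = (\<integral>\<^sup>+u. indicator B (6 * sin u) * ennreal (6 * cos u) * indicator {- (pi / 6)..pi / 6} u \<partial>lborel)"
  proof (rule nn_integral_substitution_aux)
    fix x assume "x \<in> {- (pi / 6)..pi / 6}"
    then show "0 \<le> 6 * cos x" using pi_gt_zero by (auto intro!: cos_ge_zero)
  next
    show "- (pi / 6) < pi / 6" using pi_gt_zero by linarith
  qed (auto intro!: derivative_eq_intros continuous_intros)
  also have "\<dots> \<le> (\<integral>\<^sup>+u. 6 * indicator {u \<in> {-pi/4..<pi/4}. 6 * sin u \<in> B} u \<partial>lborel)"
  proof (intro nn_integral_mono)
    fix u :: real
    have "ennreal (6 * cos u) \<le> ennreal 6" by (intro ennreal_leI) simp
    moreover have "u \<in> {- (pi / 6)..pi / 6} \<Longrightarrow> u \<in> {-pi/4..<pi/4}" using pi_gt3 by auto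
    ultimately show "indicator B (6 * sin u) * ennreal (6 * cos u) * indicator {- (pi / 6)..pi / 6} u
       \<le> (6 * indicator {u \<in> {-pi/4..<pi/4}. 6 * sin u \<in> B} u :: ennreal)"
      by (auto split: split_indicator)
  qed
  also have "\<dots> = 6 * emeasure lborel {u \<in> {-pi/4..<pi/4}. 6 * sin u \<in> B}"
    by (subst nn_integral_cmult_indicator) auto
  finally show ?thesis .
qed

text \<open>The overlap is a quarter of the autocorrelation of \<open>Q\<close> at lag 6 sin u.
  These lags cover [-3, 3] with density at least 1/6, so Tonelli gives the constant 24 = 6 *
  4.\<close>

lemma overlap_average_ge:
  fixes Q :: "real set"
  assumes [measurable]: "Q \<in> sets borel" and Q: "Q \<subseteq> {-1..1}"
  shows "(emeasure lborel Q)\<^sup>2 \<le>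
    24 * (\<integral>\<^sup>+u\<in>{-pi/4..<pi/4}. emeasure lborel {t. 4 * t - 3 * sin u \<in> Q \<and> 4 * t + 3 * sin u \<in> Q} \<partial>lborel)"
proof -
  let ?W = "{-pi/4..<pi/4}" and ?q = "emeasure lborel Q"
  let ?I = "indicator :: real set \<Rightarrow> real \<Rightarrow> ennreal"
  have [measurable]: "{t. 4 * t - 3 * sin u \<in> Q \<and> 4 * t + 3 * sin u \<in> Q} \<in> sets borel" for u by measurable
  \<comment> \<open>Substituting x = 4t - 3 sin u makes the two membership conditions x and x + 6
    sin u.\<close>
  have ov: "4 * emeasure lborel {t. 4 * t - 3 * sin u \<in> Q \<and> 4 * t + 3 * sin u \<in> Q}
     = (\<integral>\<^sup>+x. ?I Q x * ?I Q (x + 6 * sin u) \<partial>lborel)" for u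
  proof -
    have "(\<integral>\<^sup>+x. ?I Q x * ?I Q (x + 6 * sin u) \<partial>lborel)
      = ennreal \<bar>4\<bar> * (\<integral>\<^sup>+t. ?I Q (- 3 * sin u + 4 * t) * ?I Q (- 3 * sin u + 4 * t + 6 * sin u) \<partial>lborel)"
      by (rule nn_integral_real_affine) auto
    also have "(\<integral>\<^sup>+t. ?I Q (- 3 * sin u + 4 * t) * ?I Q (- 3 * sin u + 4 * t + 6 * sin u) \<partial>lborel)
      = (\<integral>\<^sup>+t. ?I {t. 4 * t - 3 * sin u \<in> Q \<and> 4 * t + 3 * sin u \<in> Q} t \<partial>lborel)"
      by (intro nn_integral_cong) (auto split: split_indicator simp: algebra_simps)
    finally show ?thesis by simp
  qed
  have inner: "?q \<le> 6 * (\<integral>\<^sup>+u. ?I Q (x + 6 * sin u) * ?I ?W u \<partial>lborel)" if "x \<in> Q" for x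
  proof -
    \<comment> \<open>\<open>B\<close> is the translate of \<open>Q\<close> by -x. It even lies in
      [-2, 2], as both x and \<open>Q\<close> are within [-1, 1].\<close>
    define B where "B = {y. x + y \<in> Q}"
    have [measurable]: "B \<in> sets borel" unfolding B_def by measurable
    have measB: "{u \<in> ?W. 6 * sin u \<in> B} \<in> sets lborel" by measurable
    have "x + y \<in> Q \<Longrightarrow> y \<in> {-3..3}" for y
      using subsetD[OF Q that] subsetD[OF Q, of "x + y"] by auto
    then have "B \<subseteq> {-3..3}" by (auto simp: B_def)
    then have "emeasure lborel B \<le> 6 * emeasure lborel {u \<in> ?W. 6 * sin u \<in> B}"
      by (intro sin_level_measure_ge) auto
    moreover have "?q = emeasure lborel B"
    proof -
      have "?q = (\<integral>\<^sup>+y. ?I Q (x + 1 * y) \<partial>lborel)"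
        using nn_integral_real_affine[of "?I Q" 1 x] by simp
      also have "\<dots> = (\<integral>\<^sup>+y. ?I B y \<partial>lborel)"
        by (intro nn_integral_cong) (auto simp: B_def split: split_indicator)
      finally show ?thesis by simp
    qed
    moreover have "emeasure lborel {u \<in> ?W. 6 * sin u \<in> B} = (\<integral>\<^sup>+u. ?I Q (x + 6 * sin u) * ?I ?W u \<partial>lborel)"
      unfolding nn_integral_indicator[OF measB, symmetric]
      by (intro nn_integral_cong) (auto simp: B_def split: split_indicator)
    ultimately show ?thesis by simp
  qed
  have "?q\<^sup>2 = (\<integral>\<^sup>+x. ?q * ?I Q x \<partial>lborel)"
    by (simp add: nn_integral_cmult_indicator power2_eq_square)
  also have "\<dots> \<le> (\<integral>\<^sup>+x. 6 * (\<integral>\<^sup>+u. ?I Q (x + 6 * sin u) * ?I ?W u \<partial>lborel) * ?I Q x \<partial>lborel)"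
    using inner by (intro nn_integral_mono) (auto split: split_indicator)
  also have "\<dots> = (\<integral>\<^sup>+x. 6 * (\<integral>\<^sup>+u. ?I Q (x + 6 * sin u) * ?I ?W u * ?I Q x \<partial>lborel) \<partial>lborel)"
  proof (intro nn_integral_cong)
    fix x
    have "(\<integral>\<^sup>+u. ?I Q (x + 6 * sin u) * ?I ?W u * ?I Q x \<partial>lborel)
       = (\<integral>\<^sup>+u. ?I Q (x + 6 * sin u) * ?I ?W u \<partial>lborel) * ?I Q x"
      by (rule nn_integral_multc) measurable
    then show "6 * (\<integral>\<^sup>+u. ?I Q (x + 6 * sin u) * ?I ?W u \<partial>lborel) * ?I Q x
       = 6 * (\<integral>\<^sup>+u. ?I Q (x + 6 * sin u) * ?I ?W u * ?I Q x \<partial>lborel)"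
      by (simp only: mult.assoc)
  qed
  also have "\<dots> = 6 * (\<integral>\<^sup>+x. (\<integral>\<^sup>+u. ?I Q (x + 6 * sin u) * ?I ?W u * ?I Q x \<partial>lborel) \<partial>lborel)"
    by (rule nn_integral_cmult) measurable
  also have "(\<integral>\<^sup>+x. (\<integral>\<^sup>+u. ?I Q (x + 6 * sin u) * ?I ?W u * ?I Q x \<partial>lborel) \<partial>lborel)
     = (\<integral>\<^sup>+u. (\<integral>\<^sup>+x. ?I Q (x + 6 * sin u) * ?I ?W u * ?I Q x \<partial>lborel) \<partial>lborel)"
    by (rule lborel_pair.Fubini') measurable
  also have "\<dots> = (\<integral>\<^sup>+u. 4 * (emeasure lborel {t. 4 * t - 3 * sin u \<in> Q \<and> 4 * t + 3 * sin u \<in> Q} * ?I ?W u) \<partial>lborel)"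
  proof (intro nn_integral_cong)
    fix u :: real
    have "(\<integral>\<^sup>+x. ?I Q (x + 6 * sin u) * ?I ?W u * ?I Q x \<partial>lborel)
       = (\<integral>\<^sup>+x. ?I Q x * ?I Q (x + 6 * sin u) * ?I ?W u \<partial>lborel)"
      by (intro nn_integral_cong) (simp add: ac_simps)
    also have "\<dots> = (\<integral>\<^sup>+x. ?I Q x * ?I Q (x + 6 * sin u) \<partial>lborel) * ?I ?W u"
      by (rule nn_integral_multc) measurable
    finally show "(\<integral>\<^sup>+x. ?I Q (x + 6 * sin u) * ?I ?W u * ?I Q x \<partial>lborel) =
       4 * (emeasure lborel {t. 4 * t - 3 * sin u \<in> Q \<and> 4 * t + 3 * sin u \<in> Q} * ?I ?W u)"
      by (simp only: ov[symmetric] mult.assoc)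
  qed
  also have "\<dots> = 4 * (\<integral>\<^sup>+u\<in>?W. emeasure lborel {t. 4 * t - 3 * sin u \<in> Q \<and> 4 * t + 3 * sin u \<in> Q} \<partial>lborel)"
    by (rule nn_integral_cmult) measurable
  finally show ?thesis by (simp add: mult.assoc[symmetric])
qed

lemma measurable_emeasure_fan [measurable]:
  assumes [measurable]: "Q \<in> sets borel"
  shows "(\<lambda>u. emeasure lborel (fan u Q)) \<in> borel_measurable borel"
  unfolding fan_def by measurable

text \<open>By periodicity the window starting at \<theta> may be replaced by the one centred at 0,
  where the sine lags cover all differences of \<open>Q\<close>. Dividing the mean overlap by the
  window length gives the constant (1/24) / (pi/2) = 1 / (12 pi).\<close>

lemma fan_average_le:
  fixes Q :: "real set"
  assumes [measurable]: "Q \<in> sets borel" and Q: "Q \<subseteq> {-1..1}" and \<theta>: "\<theta> \<in> {0..pi}"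
  shows "(\<integral>\<^sup>+s. emeasure lborel (fan (s + \<theta>) Q) \<partial>uniform_measure lborel {0..pi / 2})
     + ennreal (1 / (12 * pi)) * (emeasure lborel Q)\<^sup>2 \<le> emeasure lborel Q"
proof -
  let ?h = "\<lambda>u. emeasure lborel (fan u Q)" and ?q = "emeasure lborel Q" and ?p = "ennreal (pi / 2)"
  let ?v = "\<lambda>u. emeasure lborel {t. 4 * t - 3 * sin u \<in> Q \<and> 4 * t + 3 * sin u \<in> Q}"
  have p: "?p \<noteq> 0" "?p \<noteq> \<infinity>" by auto
  have win: "(\<integral>\<^sup>+u\<in>{a..<a + pi / 2}. ?h u \<partial>lborel) = (\<integral>\<^sup>+u\<in>{b..<b + pi / 2}. ?h u \<partial>lborel)"
    if "a \<le> b" "b \<le> a + pi / 2" for a b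
    by (rule nn_integral_periodic_window) (use that in \<open>auto simp: fan_periodic\<close>)
  have "(\<integral>\<^sup>+s. ?h (s + \<theta>) \<partial>uniform_measure lborel {0..pi / 2})
      = (\<integral>\<^sup>+s\<in>{0..pi / 2}. ?h (s + \<theta>) \<partial>lborel) / ?p"
    by (subst nn_integral_uniform_measure) auto
  \<comment> \<open>The right endpoint is a null set; removing it gives the half-open form.\<close>
  also have "(\<integral>\<^sup>+s\<in>{0..pi / 2}. ?h (s + \<theta>) \<partial>lborel) = (\<integral>\<^sup>+s\<in>{0..<pi / 2}. ?h (s + \<theta>) \<partial>lborel)"
    using AE_lborel_singleton[of "pi / 2 :: real"]
    by (intro nn_integral_cong_AE) (auto split: split_indicator elim!: eventually_mono)
  also have "\<dots> = (\<integral>\<^sup>+u\<in>{\<theta>..<\<theta> + pi / 2}. ?h u \<partial>lborel)"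
    using nn_integral_shift_window[where h = ?h and a = 0 and b = "pi / 2" and c = \<theta>] by (simp add: add.commute)
  \<comment> \<open>\<open>win\<close> moves a window by at most one period, so for \<theta> > pi/2
    the move goes through pi/2.\<close>
  also have "\<dots> = (\<integral>\<^sup>+u\<in>{0..<0 + pi / 2}. ?h u \<partial>lborel)"
    using \<theta> win[of 0 \<theta>] win[of 0 "pi / 2"] win[of "pi / 2" \<theta>] pi_gt_zero
    by (cases "\<theta> \<le> pi / 2") auto
  also have "\<dots> = (\<integral>\<^sup>+u\<in>{-pi/4..<pi/4}. ?h u \<partial>lborel)"
    using win[of "-pi/4" 0] pi_gt_zero by simp
  finally have avg: "(\<integral>\<^sup>+s. ?h (s + \<theta>) \<partial>uniform_measure lborel {0..pi / 2})
      = (\<integral>\<^sup>+u\<in>{-pi/4..<pi/4}. ?h u \<partial>lborel) / ?p" .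
  have "(\<integral>\<^sup>+u\<in>{-pi/4..<pi/4}. ?h u \<partial>lborel) + (\<integral>\<^sup>+u\<in>{-pi/4..<pi/4}. ?v u \<partial>lborel)
     = (\<integral>\<^sup>+u\<in>{-pi/4..<pi/4}. (?h u + ?v u) \<partial>lborel)"
    by (subst nn_integral_add[symmetric]) (auto simp: distrib_right)
  also have "\<dots> \<le> (\<integral>\<^sup>+u\<in>{-pi/4..<pi/4}. ?q \<partial>lborel)"
    by (intro nn_integral_mono mult_right_mono fan_add_overlap_le) auto
  also have "\<dots> = ?q * ?p"
    using pi_gt_zero by (subst nn_integral_cmult_indicator) auto
  finally have le: "(\<integral>\<^sup>+u\<in>{-pi/4..<pi/4}. ?h u \<partial>lborel) + (\<integral>\<^sup>+u\<in>{-pi/4..<pi/4}. ?v u \<partial>lborel) \<le> ?q * ?p" .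
  have "ennreal (1 / (12 * pi)) * ?q\<^sup>2
     \<le> ennreal (1 / (12 * pi)) * (24 * (\<integral>\<^sup>+u\<in>{-pi/4..<pi/4}. ?v u \<partial>lborel))"
    by (intro mult_left_mono overlap_average_ge Q) auto
  also have "\<dots> = ennreal (2 / pi) * (\<integral>\<^sup>+u\<in>{-pi/4..<pi/4}. ?v u \<partial>lborel)"
  proof -
    have "ennreal (1 / (12 * pi)) * 24 = ennreal (1 / (12 * pi)) * ennreal 24" by simp
    also have "\<dots> = ennreal (2 / pi)" by (subst ennreal_mult[symmetric]) auto
    finally show ?thesis by (simp add: mult.assoc[symmetric])
  qed
  also have "\<dots> = (\<integral>\<^sup>+u\<in>{-pi/4..<pi/4}. ?v u \<partial>lborel) / ?p"
    by (simp add: divide_ennreal_def inverse_ennreal mult.commute)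
  finally have "(\<integral>\<^sup>+s. ?h (s + \<theta>) \<partial>uniform_measure lborel {0..pi / 2}) + ennreal (1 / (12 * pi)) * ?q\<^sup>2
     \<le> ((\<integral>\<^sup>+u\<in>{-pi/4..<pi/4}. ?h u \<partial>lborel) + (\<integral>\<^sup>+u\<in>{-pi/4..<pi/4}. ?v u \<partial>lborel)) / ?p"
    unfolding avg add_divide_distrib_ennreal by (rule add_left_mono)
  also have "\<dots> \<le> ?q * ?p / ?p" by (rule divide_right_mono_ennreal[OF le])
  also have "\<dots> = ?q" using p by (intro ennreal_mult_divide_eq) auto
  finally show ?thesis .
qed

section \<open>Projections of the disks as a recursion on the first angle\<close>

text \<open>The first angle is peeled off, whereas \<open>centers\<close> peels off the last one:
  what remains is again a projection, built from later angles only. The shift by \<open>Suc\<close>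
  keeps the numbering from 1.\<close>

primrec shadow :: "real \<Rightarrow> nat \<Rightarrow> (nat \<Rightarrow> real) \<Rightarrow> real set" where
  "shadow \<theta> 0 v = {-1..1}"
| "shadow \<theta> (Suc n) v = fan (v 1 + \<theta>) (shadow \<theta> n (\<lambda>i. v (Suc i)))"

text \<open>Self-similarity: \<open>T j \<alpha>\<close> is affine with ratio 1/4, so it turns a
  last-generation displacement d / 4^n into d / 4^(n+1).\<close>

lemma centers_Suc_first:
  "centers v (Suc n) = (\<Union>j\<in>{0..3}. T j (v 1) ` centers (\<lambda>i. v (Suc i)) n)"
proof (induction n)
  case 0
  then show ?case by auto
next
  case (Suc n)
  have T_add: "T j \<alpha> (c + d / 4 ^ n) = T j \<alpha> c + d / 4 ^ Suc n" for j \<alpha> c d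
    by (simp add: T_def field_simps)
  have "centers v (Suc (Suc n)) =
     (\<Union>c\<in>centers v (Suc n). (\<lambda>j. c + T j (v (Suc (Suc n))) 0 / 4 ^ Suc n) ` {0..3})"
    by (rule centers.simps)
  also have "\<dots> = (\<Union>j\<in>{0..3}. T j (v 1) ` centers (\<lambda>i. v (Suc i)) (Suc n))"
    unfolding Suc.IH centers.simps(2)[of "\<lambda>i. v (Suc i)"] by (force simp: T_add simp del: power_Suc)
  finally show ?case .
qed

text \<open>Since \<open>cis x \<bullet> cis \<theta>\<close> is cos (x - \<theta>), angle and
  direction enter the displacement only through \<alpha> + \<theta>.\<close>

lemma inner_T:
  "T j \<alpha> z \<bullet> cis \<theta> = (z \<bullet> cis \<theta>) / 4 + 3 / 4 * cos (pi / 2 * real j - (\<alpha> + \<theta>))"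
proof -
  have "cis x \<bullet> cis \<theta> = cos (x - \<theta>)" for x
    by (simp add: inner_complex_def cos_diff)
  moreover have "T j \<alpha> z = (1 / 4) *\<^sub>R z + (3 / 4) *\<^sub>R cis (pi / 2 * real j - \<alpha>)"
    by (simp add: T_def scaleR_conv_of_real)
  ultimately show ?thesis by (simp add: inner_add_left diff_diff_eq)
qed

lemma mem_shadow_iff:
  "t \<in> shadow \<theta> n v \<longleftrightarrow> (\<exists>c\<in>centers v n. \<bar>t - c \<bullet> cis \<theta>\<bar> \<le> 1 / 4 ^ n)"
proof (induction n arbitrary: t v)
  case 0
  then show ?case by (auto simp: abs_le_iff)
next
  case (Suc n)
  define u where "u = v 1 + \<theta>"
  let ?C = "centers (\<lambda>i. v (Suc i)) n"
  define c where "c j = cos (pi / 2 * real j - u)" for j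
  \<comment> \<open>Multiplication by 4 reduces a condition on \<open>T j (v 1) z\<close> to one on
    z, one generation lower.\<close>
  have scale: "\<bar>t - T j (v 1) z \<bullet> cis \<theta>\<bar> \<le> 1 / 4 ^ Suc n \<longleftrightarrow>
     \<bar>4 * t - 3 * c j - z \<bullet> cis \<theta>\<bar> \<le> 1 / 4 ^ n" for j z
    unfolding inner_T u_def[symmetric] c_def[symmetric] by (auto simp: abs_le_iff field_simps)
  have "pi / 2 * real 3 - u = (pi / 2 - u) + pi" by simp
  then have c3: "c 3 = - sin u"
    unfolding c_def by (simp only: cos_periodic_pi) (simp add: cos_diff del: of_nat_numeral)
  have c: "c 0 = cos u" "c 1 = sin u" "c 2 = - cos u"
    by (simp_all add: c_def cos_diff)
  have ball: "(\<exists>j\<in>{0..3}. P j) \<longleftrightarrow> P 0 \<or> P 1 \<or> P 2 \<or> P 3" for P :: "nat \<Rightarrow> bool"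
  proof -
    have "{0..3} = {0, 1, 2, 3 :: nat}" by auto
    then show ?thesis by simp
  qed
  have "(\<exists>d\<in>centers v (Suc n). \<bar>t - d \<bullet> cis \<theta>\<bar> \<le> 1 / 4 ^ Suc n) \<longleftrightarrow>
     (\<exists>j\<in>{0..3}. \<exists>z\<in>?C. \<bar>t - T j (v 1) z \<bullet> cis \<theta>\<bar> \<le> 1 / 4 ^ Suc n)"
    unfolding centers_Suc_first by blast
  also have "\<dots> \<longleftrightarrow> (\<exists>j\<in>{0..3}. 4 * t - 3 * c j \<in> shadow \<theta> n (\<lambda>i. v (Suc i)))"
    unfolding scale Suc.IH ..
  also have "\<dots> \<longleftrightarrow> t \<in> shadow \<theta> (Suc n) v"
    unfolding ball c c3 by (simp add: fan_def u_def)
  finally show ?case ..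
qed

lemma image_inner_cis_cball: "(\<lambda>z. z \<bullet> cis \<theta>) ` cball c r = {t. \<bar>t - c \<bullet> cis \<theta>\<bar> \<le> r}"
proof (intro equalityI subsetI)
  fix t assume "t \<in> (\<lambda>z. z \<bullet> cis \<theta>) ` cball c r"
  then obtain z where z: "norm (z - c) \<le> r" "t = z \<bullet> cis \<theta>"
    by (force simp: dist_norm norm_minus_commute)
  then show "t \<in> {t. \<bar>t - c \<bullet> cis \<theta>\<bar> \<le> r}"
    using Cauchy_Schwarz_ineq2[of "z - c" "cis \<theta>"] by (simp add: inner_diff_left)
next
  fix t assume t: "t \<in> {t. \<bar>t - c \<bullet> cis \<theta>\<bar> \<le> r}"
  \<comment> \<open>A preimage is reached from the centre along the direction of projection.\<close>
  let ?z = "c + (t - c \<bullet> cis \<theta>) *\<^sub>R cis \<theta>"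
  have "cis \<theta> \<bullet> cis \<theta> = 1" by (simp add: dot_square_norm)
  then have "?z \<bullet> cis \<theta> = t" by (simp add: inner_add_left)
  moreover have "?z \<in> cball c r" using t by (simp add: dist_norm)
  ultimately show "t \<in> (\<lambda>z. z \<bullet> cis \<theta>) ` cball c r" by (intro rev_image_eqI[of ?z]) auto
qed

lemma image_inner_random_disks: "(\<lambda>z. z \<bullet> cis \<theta>) ` random_disks v n = shadow \<theta> n v"
  unfolding random_disks_eq image_UN image_inner_cis_cball
  by (auto simp: mem_shadow_iff)

text \<open>Angles are numbered from 1, so index 0 may hold any value. This is what later admits
  sequences restricted to an index set.\<close>

lemma shadow_cong:
  assumes "\<And>i. i \<ge> 1 \<Longrightarrow> v i = w i"
  shows "shadow \<theta> n v = shadow \<theta> n w"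
  using assms
proof (induction n arbitrary: v w)
  case (Suc n)
  have "shadow \<theta> n (\<lambda>i. v (Suc i)) = shadow \<theta> n (\<lambda>i. w (Suc i))"
    by (rule Suc.IH) (simp add: Suc.prems)
  then show ?case by (simp add: Suc.prems)
qed simp

text \<open>The unit interval is preserved because (1 + 3) / 4 = 1.\<close>

lemma shadow_subset: "shadow \<theta> n v \<subseteq> {-1..1}"
proof (induction n arbitrary: v)
  case (Suc n)
  have "\<bar>t\<bar> \<le> 1" if "4 * t + 3 * s \<in> shadow \<theta> n w" "\<bar>s\<bar> \<le> 1" for t s w
    using subsetD[OF Suc that(1)] that(2) by auto
  note bound = this
  have "\<bar>t\<bar> \<le> 1" if "t \<in> shadow \<theta> (Suc n) v" for t
    using that bound[of t "cos (v 1 + \<theta>)"] bound[of t "- cos (v 1 + \<theta>)"]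
      bound[of t "sin (v 1 + \<theta>)"] bound[of t "- sin (v 1 + \<theta>)"]
    by (auto simp: fan_def)
  then show ?case by (intro subsetI) (simp add: abs_le_iff del: shadow.simps)
qed simp

section \<open>Joint measurability in point, direction and angles\<close>

text \<open>The tested point \<open>g x\<close> must vary for the induction: unfolding
  \<open>fan\<close> replaces it by 4 g \<plusminus> 3 cos and 4 g \<plusminus> 3 sin of the first
  angle plus the direction.\<close>

lemma pred_mem_shadow:
  fixes X :: "nat \<Rightarrow> 'b \<Rightarrow> real"
  assumes "\<And>i. i \<ge> 1 \<Longrightarrow> X i \<in> borel_measurable N"
    and "g \<in> borel_measurable N" "h \<in> borel_measurable N"
  shows "Measurable.pred N (\<lambda>x. g x \<in> shadow (h x) n (\<lambda>i. X i x))"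
  using assms
proof (induction n arbitrary: g X)
  case 0
  note [measurable] = 0(2)
  show ?case unfolding shadow.simps by measurable
next
  case (Suc n)
  note [measurable] = Suc.prems(2,3)
  have [measurable]: "X 1 \<in> borel_measurable N" by (rule Suc.prems) simp
  have IH: "Measurable.pred N (\<lambda>x. f x \<in> shadow (h x) n (\<lambda>i. X (Suc i) x))"
    if "f \<in> borel_measurable N" for f
    by (rule Suc.IH) (use that Suc.prems in auto)
  show ?case
    unfolding shadow.simps fan_def mem_Collect_eq
    by (intro pred_intros_logic(5); rule IH; measurable)
qed

lemma measurable_emeasure_shadow:
  fixes X :: "nat \<Rightarrow> 'b \<Rightarrow> real"
  assumes X: "\<And>i. i \<ge> 1 \<Longrightarrow> X i \<in> borel_measurable N" and h [measurable]: "h \<in> borel_measurable N"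
  shows "(\<lambda>x. emeasure lborel (shadow (h x) n (\<lambda>i. X i x))) \<in> borel_measurable N"
proof (rule lborel.measurable_emeasure)
  have "Measurable.pred (N \<Otimes>\<^sub>M lborel) (\<lambda>y. snd y \<in> shadow (h (fst y)) n (\<lambda>i. X i (fst y)))"
  proof (rule pred_mem_shadow)
    fix i :: nat assume "i \<ge> 1"
    then have [measurable]: "X i \<in> borel_measurable N" by (rule X)
    show "(\<lambda>y. X i (fst y)) \<in> borel_measurable (N \<Otimes>\<^sub>M lborel)" by measurable
  qed measurable
  then show "{y \<in> space (N \<Otimes>\<^sub>M lborel). snd y \<in> shadow (h (fst y)) n (\<lambda>i. X i (fst y))} \<in> sets (N \<Otimes>\<^sub>M lborel)"
    by (simp add: pred_def)
qed simp

lemma shadow_borel [measurable]: "shadow \<theta> n v \<in> sets borel"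
proof -
  have "Measurable.pred borel (\<lambda>t. t \<in> shadow \<theta> n v)"
    by (rule pred_mem_shadow[where X = "\<lambda>i _. v i" and h = "\<lambda>_. \<theta>"]) simp_all
  then show ?thesis by (simp add: pred_def)
qed

lemma line_measure_random_disks:
  "line_measure \<theta> (line_proj \<theta> ` random_disks v n) = emeasure lborel (shadow \<theta> n v)"
  unfolding line_measure_line_proj image_inner_random_disks by simp

lemma emeasure_shadow_le: "emeasure lborel (shadow \<theta> n v) \<le> 2"
proof -
  have "emeasure lborel (shadow \<theta> n v) \<le> emeasure lborel {-1..1 :: real}"
    by (intro emeasure_mono shadow_subset) simp
  then show ?thesis by simp
qed

section \<open>Mean projection length for random angles\<close>

locale uniform_angles = prob_space M for M :: "'a measure" +
  fixes W :: "nat \<Rightarrow> 'a \<Rightarrow> real"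
  assumes indep: "indep_vars (\<lambda>_. borel) W {1..}"
    and uniform: "\<And>i. i \<ge> 1 \<Longrightarrow> distr M borel (W i) = uniform_measure lborel {0..pi / 2}"
begin

lemma random_variable_W: "i \<ge> 1 \<Longrightarrow> random_variable borel (W i)"
  using indep by (auto simp: indep_vars_def)

text \<open>The offset \<open>k\<close> starts the construction at angle k + 1. Bounds uniform in
  \<open>k\<close> avoid comparing the joint laws of the sequence and its shifts.\<close>

definition mean_shadow :: "real \<Rightarrow> nat \<Rightarrow> nat \<Rightarrow> ennreal" where
  "mean_shadow \<theta> k n = (\<integral>\<^sup>+x. emeasure lborel (shadow \<theta> n (\<lambda>i. W (k + i) x)) \<partial>M)"

lemma measurable_shadow_W [measurable]:
  "(\<lambda>x. emeasure lborel (shadow \<theta> n (\<lambda>i. W (k + i) x))) \<in> borel_measurable M"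
  by (rule measurable_emeasure_shadow) (auto intro: random_variable_W)

lemma mean_shadow_le: "mean_shadow \<theta> k n \<le> 2"
  unfolding mean_shadow_def
  using nn_integral_mono[of M _ "\<lambda>_. 2", OF emeasure_shadow_le] by (simp add: emeasure_space_1)

text \<open>Jensen for the square, as Cauchy-Schwarz against the constant 1.\<close>

lemma nn_integral_power2_le:
  assumes [measurable]: "f \<in> borel_measurable M"
  shows "(\<integral>\<^sup>+x. f x \<partial>M)\<^sup>2 \<le> (\<integral>\<^sup>+x. (f x)\<^sup>2 \<partial>M)"
  using Cauchy_Schwarz_nn_integral[of f M "\<lambda>_. 1"] by (simp add: emeasure_space_1)

text \<open>Angle k + 1 is independent of the later ones, so it can be averaged first with those
  frozen. \<open>fan_average_le\<close> bounds this inner mean, and Jensen handles the squared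
  length.\<close>

lemma mean_shadow_Suc_le:
  assumes \<theta>: "\<theta> \<in> {0..pi}"
  shows "mean_shadow \<theta> k (Suc n) + ennreal (1 / (12 * pi)) * (mean_shadow \<theta> (Suc k) n)\<^sup>2
    \<le> mean_shadow \<theta> (Suc k) n"
proof -
  let ?U = "uniform_measure lborel {0..pi / 2}"
  define N1 where "N1 = PiM {Suc k} (\<lambda>_::nat. borel :: real measure)"
  define N2 where "N2 = PiM {k + 2..} (\<lambda>_::nat. borel :: real measure)"
  define X where "X x = (\<lambda>i\<in>{Suc k}. W i x)" for x
  define Y where "Y x = (\<lambda>i\<in>{k + 2..}. W i x)" for x
  define G where "G s y = emeasure lborel (fan (s + \<theta>) (shadow \<theta> n (\<lambda>i. y (Suc k + i))))"
    for s :: real and y :: "nat \<Rightarrow> real"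
  let ?q = "\<lambda>x. emeasure lborel (shadow \<theta> n (\<lambda>i. W (Suc k + i) x))"
  have "indep_var N1 X N2 Y"
    unfolding N1_def N2_def X_def Y_def by (rule indep_var_restrict[OF indep]) auto
  then have X [measurable]: "random_variable N1 X" and Y [measurable]: "random_variable N2 Y"
    and joint: "distr M N1 X \<Otimes>\<^sub>M distr M N2 Y = distr M (N1 \<Otimes>\<^sub>M N2) (\<lambda>x. (X x, Y x))"
    by (auto simp: indep_var_distribution_eq)
  have W [measurable]: "random_variable borel (W (Suc k))" by (rule random_variable_W) simp
  \<comment> \<open>At i = 0 the index \<open>Suc k + i\<close> falls outside
    \<open>{k + 2..}\<close>, where \<open>Y x\<close> is undefined; \<open>shadow_cong\<close>
    compares only from i = 1 on.\<close>
  have G_W: "G s (Y x) = emeasure lborel (fan (s + \<theta>) (shadow \<theta> n (\<lambda>i. W (Suc k + i) x)))" for s x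
    unfolding G_def Y_def by (subst shadow_cong[where w = "\<lambda>i. W (Suc k + i) x"]) auto
  have G: "(\<lambda>p. G (fst p) (snd p)) \<in> borel_measurable (borel \<Otimes>\<^sub>M N2)"
  proof -
    \<comment> \<open>The free angle sits at index 1 and the later ones are read from the second
      component, so that \<open>G\<close> becomes the length of a shadow of generation
      \<open>Suc n\<close>.\<close>
    let ?Z = "\<lambda>i p. if i = 1 then fst p else snd p (k + i) :: real"
    have "(\<lambda>p. emeasure lborel (shadow \<theta> (Suc n) (\<lambda>i. ?Z i p))) \<in> borel_measurable (borel \<Otimes>\<^sub>M N2)"
    proof (rule measurable_emeasure_shadow)
      fix i :: nat assume "i \<ge> 1"
      then show "?Z i \<in> borel_measurable (borel \<Otimes>\<^sub>M N2)"
        unfolding N2_def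
        by (cases "i = 1") (auto intro!: measurable_compose[OF measurable_snd measurable_component_singleton])
    qed simp
    also have "(\<lambda>p. emeasure lborel (shadow \<theta> (Suc n) (\<lambda>i. ?Z i p))) = (\<lambda>p. G (fst p) (snd p))"
      unfolding G_def shadow.simps fun_eq_iff
      by (auto intro!: arg_cong[where f = "emeasure lborel"] arg_cong2[where f = fan] shadow_cong)
    finally show ?thesis .
  qed
  have comp [measurable]: "(\<lambda>f. f (Suc k)) \<in> borel_measurable N1"
    unfolding N1_def by (rule measurable_component_singleton) simp
  have G1 [measurable]: "(\<lambda>p. G (fst p (Suc k)) (snd p)) \<in> borel_measurable (N1 \<Otimes>\<^sub>M N2)"
    using measurable_compose[OF measurable_Pair[OF measurable_compose[OF measurable_fst comp] measurable_snd] G]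
    by simp
  have Gs [measurable]: "(\<lambda>s. G s y) \<in> borel_measurable borel" for y
    unfolding G_def by measurable
  interpret X: prob_space "distr M N1 X" by (rule prob_space_distr) fact
  interpret Y: prob_space "distr M N2 Y" by (rule prob_space_distr) fact
  interpret XY: pair_prob_space "distr M N1 X" "distr M N2 Y" ..
  have "mean_shadow \<theta> k (Suc n) = (\<integral>\<^sup>+x. G (X x (Suc k)) (Y x) \<partial>M)"
    unfolding mean_shadow_def G_W by (simp add: X_def)
  also have "\<dots> = (\<integral>\<^sup>+p. G (fst p (Suc k)) (snd p) \<partial>distr M (N1 \<Otimes>\<^sub>M N2) (\<lambda>x. (X x, Y x)))"
    by (subst nn_integral_distr) auto
  \<comment> \<open>Independence has made the joint law a product; Tonelli puts the first angle
    inside.\<close>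
  also have "\<dots> = (\<integral>\<^sup>+y. \<integral>\<^sup>+f. G (f (Suc k)) y \<partial>distr M N1 X \<partial>distr M N2 Y)"
    unfolding joint[symmetric] by (subst XY.nn_integral_snd[symmetric]) auto
  also have "\<dots> = (\<integral>\<^sup>+x. \<integral>\<^sup>+f. G (f (Suc k)) (Y x) \<partial>distr M N1 X \<partial>M)"
  proof -
    have "(\<lambda>p. G (snd p (Suc k)) (fst p)) \<in> borel_measurable (N2 \<Otimes>\<^sub>M distr M N1 X)"
      using measurable_compose[OF _ G1, of "\<lambda>p. (snd p, fst p)" "N2 \<Otimes>\<^sub>M distr M N1 X"] by simp
    from X.borel_measurable_nn_integral_fst[OF this] show ?thesis
      by (subst nn_integral_distr) auto
  qed
  also have "\<dots> = (\<integral>\<^sup>+x. \<integral>\<^sup>+s. G s (Y x) \<partial>?U \<partial>M)"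
  proof (intro nn_integral_cong)
    fix x
    have "(\<integral>\<^sup>+f. G (f (Suc k)) (Y x) \<partial>distr M N1 X) = (\<integral>\<^sup>+x'. G (W (Suc k) x') (Y x) \<partial>M)"
      by (subst nn_integral_distr) (auto simp: X_def)
    also have "\<dots> = (\<integral>\<^sup>+s. G s (Y x) \<partial>distr M borel (W (Suc k)))"
      by (subst nn_integral_distr) auto
    finally show "(\<integral>\<^sup>+f. G (f (Suc k)) (Y x) \<partial>distr M N1 X) = (\<integral>\<^sup>+s. G s (Y x) \<partial>?U)"
      by (simp add: uniform)
  qed
  finally have step: "mean_shadow \<theta> k (Suc n) = (\<integral>\<^sup>+x. \<integral>\<^sup>+s. G s (Y x) \<partial>?U \<partial>M)" .
  have meas: "(\<lambda>x. \<integral>\<^sup>+s. G s (Y x) \<partial>?U) \<in> borel_measurable M"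
  proof -
    interpret U: prob_space ?U using prob_space_distr[OF W] uniform[of "Suc k"] by simp
    have "(\<lambda>p. G (snd p) (Y (fst p))) \<in> borel_measurable (M \<Otimes>\<^sub>M ?U)"
      using measurable_compose[OF _ G, of "\<lambda>p. (snd p, Y (fst p))" "M \<Otimes>\<^sub>M ?U"] by simp
    from U.borel_measurable_nn_integral_fst[OF this] show ?thesis by simp
  qed
  have "mean_shadow \<theta> k (Suc n) + ennreal (1 / (12 * pi)) * (mean_shadow \<theta> (Suc k) n)\<^sup>2
     \<le> (\<integral>\<^sup>+x. \<integral>\<^sup>+s. G s (Y x) \<partial>?U \<partial>M) + ennreal (1 / (12 * pi)) * (\<integral>\<^sup>+x. (?q x)\<^sup>2 \<partial>M)"
    unfolding step unfolding mean_shadow_def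
    by (intro add_left_mono mult_left_mono nn_integral_power2_le measurable_shadow_W) simp
  also have "\<dots> = (\<integral>\<^sup>+x. (\<integral>\<^sup>+s. G s (Y x) \<partial>?U) + ennreal (1 / (12 * pi)) * (?q x)\<^sup>2 \<partial>M)"
  proof -
    have [measurable]: "?q \<in> borel_measurable M" by (rule measurable_shadow_W)
    have "(\<integral>\<^sup>+x. ennreal (1 / (12 * pi)) * (?q x)\<^sup>2 \<partial>M) = ennreal (1 / (12 * pi)) * (\<integral>\<^sup>+x. (?q x)\<^sup>2 \<partial>M)"
      by (rule nn_integral_cmult) measurable
    moreover have "(\<lambda>x. ennreal (1 / (12 * pi)) * (?q x)\<^sup>2) \<in> borel_measurable M" by measurable
    ultimately show ?thesis by (simp only: nn_integral_add[OF meas])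
  qed
  also have "\<dots> \<le> mean_shadow \<theta> (Suc k) n"
    unfolding mean_shadow_def G_W
    by (intro nn_integral_mono fan_average_le shadow_subset \<theta>) auto
  finally show ?thesis .
qed

text \<open>With \<open>y = a / (12\<pi>)\<close>, the quadratic decrement preserves \<open>n y \<le> 1\<close> since
  \<open>(n + 1) y (1 - y) \<le> (1 + y) (1 - y) \<le> 1\<close>.\<close>

lemma mean_shadow_le_inverse:
  assumes \<theta>: "\<theta> \<in> {0..pi}"
  shows "real n * enn2real (mean_shadow \<theta> k n) \<le> 12 * pi"
proof (induction n arbitrary: k)
  case (Suc n)
  define a where "a = enn2real (mean_shadow \<theta> (Suc k) n)"
  define b where "b = enn2real (mean_shadow \<theta> k (Suc n))"
  define y where "y = a / (12 * pi)"
  \<comment> \<open>Finiteness matters: \<open>enn2real\<close> sends infinity to 0, so otherwise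
    \<open>a\<close> and \<open>b\<close> need not represent the means.\<close>
  have "mean_shadow \<theta> j m < \<infinity>" for j m
    by (rule le_less_trans[OF mean_shadow_le]) simp
  then have ab: "mean_shadow \<theta> (Suc k) n = ennreal a" "mean_shadow \<theta> k (Suc n) = ennreal b"
    unfolding a_def b_def by simp_all
  have nonneg: "a \<ge> 0" "b \<ge> 0" "y \<ge> 0" by (simp_all add: a_def b_def y_def)
  have "ennreal (b + 1 / (12 * pi) * a\<^sup>2) = ennreal b + ennreal (1 / (12 * pi)) * (ennreal a)\<^sup>2"
    using nonneg by (simp add: ennreal_mult[symmetric] ennreal_power)
  also have "\<dots> \<le> ennreal a"
    using mean_shadow_Suc_le[OF \<theta>, of k n] unfolding ab .
  finally have "ennreal (b + 1 / (12 * pi) * a\<^sup>2) \<le> ennreal a" .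
  then have "b + 1 / (12 * pi) * a\<^sup>2 \<le> a" using ennreal_le_iff[OF nonneg(1)] by blast
  then have "b / (12 * pi) \<le> y * (1 - y)"
    by (simp add: y_def field_simps power2_eq_square)
  then have "real (Suc n) * (b / (12 * pi)) \<le> real (Suc n) * (y * (1 - y))"
    by (intro mult_left_mono) auto
  also have "\<dots> \<le> 1"
  proof (cases "y \<le> 1")
    case True
    have "real n * y \<le> 1"
      using Suc.IH[of "Suc k"] unfolding y_def a_def by (simp add: field_simps)
    then have "real (Suc n) * y * (1 - y) \<le> (1 + y) * (1 - y)"
      using True by (intro mult_right_mono) (auto simp: algebra_simps)
    also have "\<dots> \<le> 1" by (simp add: algebra_simps)
    finally show ?thesis by (simp add: mult.assoc)
  next
    case False
    then have "real (Suc n) * (y * (1 - y)) \<le> 0" using nonneg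
      by (intro mult_nonneg_nonpos) auto
    then show ?thesis by simp
  qed
  finally show ?case unfolding b_def by (simp add: field_simps)
qed simp

lemma mean_line_measure_le:
  assumes \<theta>: "\<theta> \<in> {0..pi}" and n: "n \<ge> 1"
  shows "(\<integral>\<^sup>+x. line_measure \<theta> (line_proj \<theta> ` random_disks (\<lambda>i. W i x) n) \<partial>M) \<le> ennreal (12 * pi / real n)"
proof -
  have "mean_shadow \<theta> 0 n < \<infinity>"
    by (rule le_less_trans[OF mean_shadow_le]) simp
  then have "mean_shadow \<theta> 0 n = ennreal (enn2real (mean_shadow \<theta> 0 n))" by simp
  also have "\<dots> \<le> ennreal (12 * pi / real n)"
    using mean_shadow_le_inverse[OF \<theta>, of n 0] n by (intro ennreal_leI) (simp add: field_simps)
  finally show ?thesis by (simp add: mean_shadow_def line_measure_random_disks)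
qed

section \<open>Favard length: expectation and almost sure liminf\<close>

lemma measurable_shadow_pair:
  "(\<lambda>(x, \<theta>). emeasure lborel (shadow \<theta> n (\<lambda>i. W i x)) * indicator {0..pi} \<theta>)
     \<in> borel_measurable (M \<Otimes>\<^sub>M lborel)"
proof -
  have [measurable]: "(\<lambda>p. emeasure lborel (shadow (snd p) n (\<lambda>i. W i (fst p)))) \<in> borel_measurable (M \<Otimes>\<^sub>M lborel)"
    by (rule measurable_emeasure_shadow)
      (auto intro: measurable_compose[OF measurable_fst random_variable_W])
  show ?thesis unfolding case_prod_beta by measurable
qed

text \<open>Completing a measure leaves nonnegative integrals unchanged, so \<open>lebesgue\<close>
  becomes \<open>lborel\<close>, the form used for Tonelli.\<close>

lemma Fav_random_disks:
  "Fav (random_disks v n) = (\<integral>\<^sup>+\<theta>\<in>{0..pi}. emeasure lborel (shadow \<theta> n v) \<partial>lborel) / ennreal pi"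
  by (simp add: Fav_def line_measure_random_disks nn_integral_completion)

lemma measurable_Fav [measurable]:
  "(\<lambda>x. Fav (random_disks (\<lambda>i. W i x) n)) \<in> borel_measurable M"
  using lborel.borel_measurable_nn_integral_fst[OF measurable_shadow_pair]
  unfolding Fav_random_disks by simp

text \<open>Tonelli exchanges expectation and direction. The bound is uniform in \<theta>, so the
  interval length pi cancels the normalization and the constant is kept.\<close>

lemma mean_Fav_le:
  assumes n: "n \<ge> 1"
  shows "(\<integral>\<^sup>+x. Fav (random_disks (\<lambda>i. W i x) n) \<partial>M) \<le> ennreal (12 * pi / real n)"
proof -
  interpret pair_sigma_finite M lborel ..
  let ?L = "\<lambda>x \<theta>. emeasure lborel (shadow \<theta> n (\<lambda>i. W i x)) * indicator {0..pi} \<theta>"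
  have "(\<integral>\<^sup>+x. Fav (random_disks (\<lambda>i. W i x) n) \<partial>M) = (\<integral>\<^sup>+x. (\<integral>\<^sup>+\<theta>. ?L x \<theta> \<partial>lborel) \<partial>M) / ennreal pi"
    unfolding Fav_random_disks
    using lborel.borel_measurable_nn_integral_fst[OF measurable_shadow_pair]
    by (subst nn_integral_divide) auto
  also have "(\<integral>\<^sup>+x. (\<integral>\<^sup>+\<theta>. ?L x \<theta> \<partial>lborel) \<partial>M) = (\<integral>\<^sup>+\<theta>. (\<integral>\<^sup>+x. ?L x \<theta> \<partial>M) \<partial>lborel)"
    by (rule Fubini'[symmetric]) (rule measurable_shadow_pair)
  also have "\<dots> \<le> (\<integral>\<^sup>+\<theta>. ennreal (12 * pi / real n) * indicator {0..pi} \<theta> \<partial>lborel)"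
    using mean_line_measure_le[OF _ n]
    by (intro nn_integral_mono) (auto simp: line_measure_random_disks split: split_indicator)
  also have "\<dots> = ennreal (12 * pi / real n) * ennreal pi"
    by (subst nn_integral_cmult_indicator) auto
  finally have "(\<integral>\<^sup>+x. Fav (random_disks (\<lambda>i. W i x) n) \<partial>M) \<le> ennreal (12 * pi / real n) * ennreal pi / ennreal pi"
    by (simp add: divide_right_mono_ennreal)
  also have "\<dots> = ennreal (12 * pi / real n)" by (intro ennreal_mult_divide_eq) auto
  finally show ?thesis .
qed

text \<open>By Fatou the liminf has integral at most 12 pi, hence is finite almost
  everywhere.\<close>

lemma AE_liminf_Fav:
  "AE x in M. liminf (\<lambda>n. of_nat n * Fav (random_disks (\<lambda>i. W i x) n)) < \<infinity>"
proof -
  let ?F = "\<lambda>n x. of_nat n * Fav (random_disks (\<lambda>i. W i x) n) :: ennreal"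
  have bound: "(\<integral>\<^sup>+x. ?F n x \<partial>M) \<le> ennreal (12 * pi)" for n
  proof (cases "n \<ge> 1")
    case True
    have "(\<integral>\<^sup>+x. ?F n x \<partial>M) = ennreal (real n) * (\<integral>\<^sup>+x. Fav (random_disks (\<lambda>i. W i x) n) \<partial>M)"
      by (simp add: nn_integral_cmult ennreal_of_nat_eq_real_of_nat)
    also have "\<dots> \<le> ennreal (real n) * ennreal (12 * pi / real n)"
      by (intro mult_left_mono mean_Fav_le True) simp
    also have "\<dots> = ennreal (12 * pi)"
      using True by (subst ennreal_mult[symmetric]) auto
    finally show ?thesis .
  \<comment> \<open>At n = 0 the factor \<open>of_nat n\<close> vanishes, so the bound holds for
    every n.\<close>
  next
    case False
    then have "n = 0" by simp
    then show ?thesis by simp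
  qed
  have "(\<integral>\<^sup>+x. liminf (\<lambda>n. ?F n x) \<partial>M) \<le> liminf (\<lambda>n. \<integral>\<^sup>+x. ?F n x \<partial>M)"
    by (rule nn_integral_liminf) measurable
  also have "\<dots> \<le> ennreal (12 * pi)"
    using Liminf_mono[of "\<lambda>n. \<integral>\<^sup>+x. ?F n x \<partial>M" "\<lambda>_. ennreal (12 * pi)" sequentially] bound
    by (simp add: Liminf_const)
  finally have "(\<integral>\<^sup>+x. liminf (\<lambda>n. ?F n x) \<partial>M) \<noteq> \<infinity>" by (auto simp: top_unique)
  moreover have "(\<lambda>x. liminf (\<lambda>n. ?F n x)) \<in> borel_measurable M" by measurable
  ultimately have "AE x in M. liminf (\<lambda>n. ?F n x) \<noteq> \<infinity>" by (intro nn_integral_PInf_AE)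
  then show ?thesis by (auto simp: less_top)
qed

end

theorem theorem1:
  fixes M :: "'a measure" and \<omega> :: "nat \<Rightarrow> 'a \<Rightarrow> real"
  assumes "prob_space M"
    and "prob_space.indep_vars M (\<lambda>_. borel) \<omega> {1..}"
    and "\<And>i. i \<ge> 1 \<Longrightarrow> distr M borel (\<omega> i) = uniform_measure lborel {0..pi / 2}"
  shows "(\<exists>C::real. C > 0 \<and>
           (\<forall>\<theta>\<in>{0..pi}. \<forall>n\<ge>1.
              (\<integral>\<^sup>+x. line_measure \<theta> (line_proj \<theta> ` random_disks (\<lambda>i. \<omega> i x) n) \<partial>M)
                \<le> ennreal (C / real n)) \<and>
           (\<forall>n\<ge>1. (\<integral>\<^sup>+x. Fav (random_disks (\<lambda>i. \<omega> i x) n) \<partial>M) \<le> ennreal (C / real n))) \<and>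
         (AE x in M. liminf (\<lambda>n. of_nat n * Fav (random_disks (\<lambda>i. \<omega> i x) n)) < \<infinity>)"
proof -
  interpret uniform_angles M \<omega>
    using assms by (simp add: uniform_angles_def uniform_angles_axioms_def)
  show ?thesis
    using mean_line_measure_le mean_Fav_le AE_liminf_Fav
    by (intro conjI exI[of _ "12 * pi"]) auto
qed

end
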